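(* Suppose that $E e^{u\eta_1}<\infty$ for all $0\le u<\infty$, that $$E\log(1+|\eta_1|)<\infty,$$ and that $$\int_1^\infty e^{uy-\phi(u)}u^{-1}\,du<\infty\quad\text{for every } y\in D.$$ Set $$H(y)=\frac{1}{\log(1/\lambda)}\int_0^\infty (e^{uy}-1)e^{-\phi(u)}u^{-1}\,du,\quad y\in D.$$ Then the process $H(X_n)-n$, $n=0,1,2,\dots$, is a martingale with respect to the filtration $\mathcal{F}_n=\sigma\{X_0,X_1,\dots,X_n\}$.
   Context: Let $\{\eta_n\}_{n\ge 1}$ be a sequence of independent identically distributed real random variables, and let $\lambda$ and $x$ be nonrandom real constants with $0<\lambda<1$. The AR(1) sequence $(X_n)_{n\ge 0}$ is defined by $X_0=x$ and $X_n=\lambda X_{n-1}+\eta_n$ for $n=1,2,\dots$. The set $D\subset\mathbb{R}$ denotes the domain (state space) of the process, i.e. the set of values taken by $X_n$, $n=0,1,2,\dots$ (so $x\in D$ and $X_n\in D$ almost surely for all $n$). The cumulant function of $\eta_1$ is $\psi(u)=\log E e^{u\eta_1}$, $0\le u<\infty$, and $\phi(u)=\sum_{k=0}^\infty\psi(\lambda^k u)$, $0\le u<\infty$ (this series converges to a finite value when $E e^{u\eta_1}<\infty$ for all $u\ge0$ and $E\log(1+|\eta_1|)<\infty$).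
   Formalization: The integral defining H(y) is additionally assumed to converge absolutely for every y in D; without this H can be −∞ on D (e.g. η=0, x=−1, where φ=0 and all stated conditions hold). *)

theory Defs
  imports "HOL-Probability.Probability"
begin

primrec ar1 :: "real \<Rightarrow> real \<Rightarrow> (nat \<Rightarrow> 'a \<Rightarrow> real) \<Rightarrow> nat \<Rightarrow> 'a \<Rightarrow> real" where
  "ar1 lam x \<eta> 0 = (\<lambda>\<omega>. x)"
| "ar1 lam x \<eta> (Suc n) = (\<lambda>\<omega>. lam * ar1 lam x \<eta> n \<omega> + \<eta> (Suc n) \<omega>)"

definition cumulant :: "'a measure \<Rightarrow> ('a \<Rightarrow> real) \<Rightarrow> real \<Rightarrow> real" where
  "cumulant M Z u = ln (\<integral>\<omega>. exp (u * Z \<omega>) \<partial>M)"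

definition cumulant_series :: "'a measure \<Rightarrow> real \<Rightarrow> ('a \<Rightarrow> real) \<Rightarrow> real \<Rightarrow> real" where
  "cumulant_series M lam Z u = (\<Sum>k. cumulant M Z (lam ^ k * u))"

definition H_integrand :: "(real \<Rightarrow> real) \<Rightarrow> real \<Rightarrow> real \<Rightarrow> real" where
  "H_integrand \<phi> y u = (exp (u * y) - 1) * exp (- \<phi> u) / u"

(* The value is 0 by convention at points y where the integrand is not integrable. *)
definition H_fun :: "real \<Rightarrow> (real \<Rightarrow> real) \<Rightarrow> real \<Rightarrow> real" where
  "H_fun lam \<phi> y = 1 / ln (1 / lam) * (LBINT u:{0<..}. H_integrand \<phi> y u)"

definition natural_filtration ::
    "'a measure \<Rightarrow> (nat \<Rightarrow> 'a \<Rightarrow> real) \<Rightarrow> nat \<Rightarrow> 'a measure" where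
  "natural_filtration M X n =
     sigma (space M) {X k -` B \<inter> space M | k B. k \<le> n \<and> B \<in> sets borel}"

definition martingale ::
    "'a measure \<Rightarrow> (nat \<Rightarrow> 'a measure) \<Rightarrow> (nat \<Rightarrow> 'a \<Rightarrow> real) \<Rightarrow> bool" where
  "martingale M F Y \<longleftrightarrow>
     filtration (space M) F \<and>
     (\<forall>n. subalgebra M (F n)) \<and>
     (\<forall>n. Y n \<in> borel_measurable (F n)) \<and>
     (\<forall>n. integrable M (Y n)) \<and>
     (\<forall>m n. m \<le> n \<longrightarrow> (AE \<omega> in M. real_cond_exp M (F m) (Y n) \<omega> = Y m \<omega>))"

end

theory Submission
  imports Defs
begin

text \<open>
  The identity behind the theorem concerns one step of the chain. Let \<open>\<mu>\<close> be the law of the innovations,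
  \<open>\<psi>\<close> its cumulant function and \<open>f u = exp (u * y - \<phi> u)\<close>. Since \<open>\<phi> u = \<psi> u + \<phi> (lam * u)\<close>, averaging
  \<open>exp (u * (lam * y + t)) * exp (- \<phi> u)\<close> over \<open>t\<close> gives \<open>f (lam * u)\<close>. By Fubini, the mean of \<open>H\<close> after a
  step from \<open>y\<close> therefore exceeds \<open>H y\<close> by the integral of \<open>(f (lam * u) - f u) / u\<close> over the positive half-line,
  divided by \<open>ln (1 / lam)\<close>. This is a Frullani integral: as \<open>f\<close> tends to 1 at 0 and \<open>f u / u\<close> is
  integrable at infinity, its value is \<open>ln (1 / lam)\<close>, and the increment is 1 (\<open>H_fun_step\<close>).

  Two estimates justify this. First, the cumulant series must converge and tend to 0 at 0. The
  telescoping bound \<open>one_minus_exp_le_log_diff\<close> converts the logarithmic moment into summability of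
  \<open>dev (lam ^ k)\<close>, where \<open>dev u\<close> is the mean of \<open>\<bar>exp (u * t) - 1\<bar>\<close>; since \<open>dev\<close> is monotone, this gives
  convergence, the limit at 0 and integrability of \<open>dev u / u\<close> near 0. Secondly, Fubini needs the
  absolute version \<open>abs_H\<close> of \<open>H\<close>, whose mean after one step is at most \<open>C1 + C2 * abs_H y\<close>
  (\<open>abs_H_step_le\<close>). By iteration, \<open>abs_H (X n)\<close> has finite mean for all \<open>n\<close>, because \<open>abs_H\<close> is finite at the
  starting point.

  Finally, events of the natural filtration up to time \<open>n\<close> depend only on the first \<open>n\<close> innovations,
  which are independent of the next one. So the one-step identity holds after integration over any
  such event, and the martingale property follows by induction from the tower rule.
\<close>

section \<open>Elementary inequalities for the exponential\<close>

lemma abs_exp_minus_one_mono: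
  fixes u v t :: real
  assumes "0 \<le> u" "u \<le> v"
  shows "\<bar>exp (u * t) - 1\<bar> \<le> \<bar>exp (v * t) - 1\<bar>"
proof (cases "t \<ge> 0")
  case True
  then have "u * t \<le> v * t" "0 \<le> u * t" using assms by (auto simp: mult_right_mono)
  then show ?thesis by simp
next
  case False
  then have "v * t \<le> u * t" "u * t \<le> 0"
    using assms by (auto simp: mult_right_mono_neg mult_nonneg_nonpos)
  then show ?thesis by simp
qed

lemma exp_minus_one_le_scaled:
  fixes c t :: real
  assumes "0 \<le> c" "c \<le> 1"
  shows "exp (c * t) - 1 \<le> c * (exp t - 1)"
  using convex_onD[OF exp_convex assms, of 0 t] by (simp add: algebra_simps)

text \<open>The right-hand side telescopes when \<open>t\<close> is replaced by \<open>lam ^ k * t\<close>. This is how a logarithmic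
  moment controls \<open>\<Sum>k. 1 - exp (- lam ^ k * t)\<close>.\<close>

lemma one_minus_exp_le_log_diff:
  fixes t lam :: real
  assumes "0 \<le> t" "0 < lam" "lam < 1"
  shows "1 - exp (- t) \<le> 2 / (1 - lam) * (ln (1 + t) - ln (1 + lam * t))"
proof -
  have "1 - exp (- t) \<le> 2 * (t / (1 + t))"
  proof (cases "t \<le> 1")
    case True
    have "1 - exp (- t) \<le> t" using exp_ge_add_one_self[of "- t"] by simp
    also have "\<dots> \<le> 2 * (t / (1 + t))"
      using True assms mult_left_mono[of t 1 t] by (simp add: field_simps)
    finally show ?thesis .
  next
    case False
    have "1 - exp (- t) \<le> 1" by simp
    also have "\<dots> \<le> 2 * (t / (1 + t))" using False by (simp add: field_simps)
    finally show ?thesis .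
  qed
  also have "t / (1 + t) \<le> (ln (1 + t) - ln (1 + lam * t)) / (1 - lam)"
  proof -
    have pos: "0 < 1 + t" "0 < 1 + lam * t" using assms by (auto intro: add_pos_nonneg)
    have "ln ((1 + lam * t) / (1 + t)) \<le> (1 + lam * t) / (1 + t) - 1"
      using pos by (intro ln_le_minus_one) auto
    also have "(1 + lam * t) / (1 + t) - 1 = - ((1 - lam) * (t / (1 + t)))"
      using pos by (simp add: field_simps)
    finally have "(1 - lam) * (t / (1 + t)) \<le> ln (1 + t) - ln (1 + lam * t)"
      using pos by (simp add: ln_div)
    then show ?thesis using assms by (simp add: pos_le_divide_eq mult.commute)
  qed
  finally show ?thesis by simp
qed

lemma sum_abs_exp_minus_one_le:
  fixes t lam :: real
  assumes "0 < lam" "lam < 1"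
  shows "(\<Sum>k<n. \<bar>exp (lam ^ k * t) - 1\<bar>) \<le> (exp t + 2 * ln (1 + \<bar>t\<bar>)) / (1 - lam)"
proof (cases "t \<ge> 0")
  case True
  have "(\<Sum>k<n. \<bar>exp (lam ^ k * t) - 1\<bar>) \<le> (\<Sum>k<n. lam ^ k * exp t)"
  proof (intro sum_mono)
    fix k
    have "\<bar>exp (lam ^ k * t) - 1\<bar> = exp (lam ^ k * t) - 1" using True assms by simp
    also have "\<dots> \<le> lam ^ k * (exp t - 1)"
      using assms by (intro exp_minus_one_le_scaled) (auto simp: power_le_one)
    also have "\<dots> \<le> lam ^ k * exp t" using assms by (intro mult_left_mono) auto
    finally show "\<bar>exp (lam ^ k * t) - 1\<bar> \<le> lam ^ k * exp t" .
  qed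
  also have "\<dots> = exp t * (\<Sum>k<n. lam ^ k)" by (simp add: sum_distrib_left mult.commute)
  also have "\<dots> \<le> exp t * (1 / (1 - lam))"
    using assms by (intro mult_left_mono) (auto simp: sum_gp_strict divide_right_mono)
  also have "\<dots> \<le> (exp t + 2 * ln (1 + \<bar>t\<bar>)) / (1 - lam)"
    using assms by (simp add: divide_right_mono)
  finally show ?thesis .
next
  case False
  let ?L = "\<lambda>k. ln (1 + lam ^ k * \<bar>t\<bar>)"
  have "(\<Sum>k<n. \<bar>exp (lam ^ k * t) - 1\<bar>) \<le> (\<Sum>k<n. 2 / (1 - lam) * (?L k - ?L (Suc k)))"
  proof (intro sum_mono)
    fix k
    have "\<bar>exp (lam ^ k * t) - 1\<bar> = 1 - exp (- (lam ^ k * \<bar>t\<bar>))"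
      using False assms by (simp add: mult_nonneg_nonpos)
    also have "\<dots> \<le> 2 / (1 - lam) * (?L k - ?L (Suc k))"
      using one_minus_exp_le_log_diff[of "lam ^ k * \<bar>t\<bar>" lam] assms by (simp add: mult.assoc)
    finally show "\<bar>exp (lam ^ k * t) - 1\<bar> \<le> 2 / (1 - lam) * (?L k - ?L (Suc k))" .
  qed
  also have "\<dots> = 2 / (1 - lam) * (\<Sum>k<n. ?L k - ?L (Suc k))"
    by (rule sum_distrib_left[symmetric])
  also have "(\<Sum>k<n. ?L k - ?L (Suc k)) = ?L 0 - ?L n"
    by (rule sum_lessThan_telescope')
  also have "2 / (1 - lam) * (?L 0 - ?L n) \<le> 2 / (1 - lam) * ?L 0" using assms by (intro mult_left_mono) auto
  also have "\<dots> \<le> (exp t + 2 * ln (1 + \<bar>t\<bar>)) / (1 - lam)"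
    using assms by (simp add: divide_right_mono)
  finally show ?thesis .
qed

lemma abs_ln_le:
  fixes m :: real
  assumes "\<bar>m - 1\<bar> \<le> 1 / 2"
  shows "\<bar>ln m\<bar> \<le> 2 * \<bar>m - 1\<bar>"
proof -
  define x where "x = m - 1"
  have x: "\<bar>x\<bar> \<le> 1 / 2" using assms by (simp add: x_def)
  have "2 * x\<^sup>2 = 2 * \<bar>x\<bar> * \<bar>x\<bar>" by (simp add: power2_eq_square)
  also have "\<dots> \<le> 1 * \<bar>x\<bar>" using x by (intro mult_right_mono) auto
  finally have "2 * x\<^sup>2 \<le> \<bar>x\<bar>" by simp
  then have "\<bar>ln (1 + x)\<bar> \<le> 2 * \<bar>x\<bar>"
    using abs_ln_one_plus_x_minus_x_bound[OF x] by linarith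
  then show ?thesis by (simp add: x_def)
qed

section \<open>The cumulant series\<close>

text \<open>A probability law on the line having all positive exponential moments and a logarithmic moment,
  together with a contraction factor.\<close>

locale innovation_law = prob_space \<mu> for \<mu> :: "real measure" +
  fixes lam :: real
  assumes sets_law [measurable_cong, simp]: "sets \<mu> = sets borel"
    and lam_pos: "0 < lam" and lam_less_1: "lam < 1"
    and exp_integrable: "\<And>u. u \<ge> 0 \<Longrightarrow> integrable \<mu> (\<lambda>t. exp (u * t))"
    and log_integrable: "integrable \<mu> (\<lambda>t. ln (1 + \<bar>t\<bar>))"
begin

lemma space_law [simp]: "space \<mu> = UNIV"
  using sets_eq_imp_space_eq[OF sets_law] by simp

text \<open>The moment generating function, the cumulant function and the cumulant series of the law.\<close>

abbreviation mgf :: "real \<Rightarrow> real" where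
  "mgf u \<equiv> \<integral>t. exp (u * t) \<partial>\<mu>"

abbreviation \<psi> :: "real \<Rightarrow> real" where
  "\<psi> \<equiv> cumulant \<mu> (\<lambda>t. t)"

abbreviation \<phi> :: "real \<Rightarrow> real" where
  "\<phi> \<equiv> cumulant_series \<mu> lam (\<lambda>t. t)"

text \<open>The mean deviation of \<open>exp (u * t)\<close> from 1. It dominates \<open>\<bar>mgf u - 1\<bar>\<close> and, unlike the latter,
  it is monotone in \<open>u\<close>.\<close>

definition dev :: "real \<Rightarrow> real" where
  "dev u = (\<integral>t. \<bar>exp (u * t) - 1\<bar> \<partial>\<mu>)"

lemma dev_integrable: "u \<ge> 0 \<Longrightarrow> integrable \<mu> (\<lambda>t. \<bar>exp (u * t) - 1\<bar>)"
  using exp_integrable by auto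

lemma dev_nonneg: "0 \<le> dev u"
  unfolding dev_def by simp

lemma dev_mono: "0 \<le> u \<Longrightarrow> u \<le> v \<Longrightarrow> dev u \<le> dev v"
  unfolding dev_def by (intro integral_mono dev_integrable abs_exp_minus_one_mono) auto

lemma mgf_pos: "u \<ge> 0 \<Longrightarrow> 0 < mgf u"
  by (rule integral_less_AE_space[of "\<lambda>_. 0", simplified])
     (auto simp: exp_integrable emeasure_space_1[simplified])

lemma abs_mgf_minus_one_le_dev:
  assumes "u \<ge> 0"
  shows "\<bar>mgf u - 1\<bar> \<le> dev u"
proof -
  have "mgf u - 1 = (\<integral>t. exp (u * t) - 1 \<partial>\<mu>)"
    using exp_integrable[OF assms] by (simp add: prob_space[simplified])
  then show ?thesis unfolding dev_def by (metis integral_abs_bound)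
qed

lemma abs_cumulant_le_dev:
  assumes "u \<ge> 0" "dev u \<le> 1 / 2"
  shows "\<bar>\<psi> u\<bar> \<le> 2 * dev u"
proof -
  have "\<bar>ln (mgf u)\<bar> \<le> 2 * \<bar>mgf u - 1\<bar>"
    using abs_mgf_minus_one_le_dev[OF assms(1)] assms(2) by (intro abs_ln_le) linarith
  also have "\<dots> \<le> 2 * dev u"
    using abs_mgf_minus_one_le_dev[OF assms(1)] by simp
  finally show ?thesis unfolding cumulant_def .
qed

lemma dev_summable: "summable (\<lambda>k. dev (lam ^ k))"
proof (rule summableI_nonneg_bounded)
  show "0 \<le> dev (lam ^ k)" for k by (rule dev_nonneg)
  fix n
  have int: "integrable \<mu> (\<lambda>t. (exp t + 2 * ln (1 + \<bar>t\<bar>)) / (1 - lam))"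
    using exp_integrable[of 1] log_integrable by auto
  have "(\<Sum>k<n. dev (lam ^ k)) = (\<integral>t. (\<Sum>k<n. \<bar>exp (lam ^ k * t) - 1\<bar>) \<partial>\<mu>)"
    unfolding dev_def using lam_pos by (subst Bochner_Integration.integral_sum) (auto intro!: dev_integrable)
  also have "\<dots> \<le> (\<integral>t. (exp t + 2 * ln (1 + \<bar>t\<bar>)) / (1 - lam) \<partial>\<mu>)"
    using lam_pos lam_less_1
    by (intro integral_mono int sum_abs_exp_minus_one_le Bochner_Integration.integrable_sum dev_integrable) auto
  finally show "(\<Sum>k<n. dev (lam ^ k)) \<le> (\<integral>t. (exp t + 2 * ln (1 + \<bar>t\<bar>)) / (1 - lam) \<partial>\<mu>)" .
qed

text \<open>For small \<open>u\<close> the terms of the series are dominated by a tail of the summable sequence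
  \<open>dev (lam ^ k)\<close>.\<close>

lemma cumulant_series_small:
  assumes m: "dev (lam ^ m) \<le> 1 / 2" and u: "0 \<le> u" "u \<le> lam ^ m"
  shows "summable (\<lambda>k. \<psi> (lam ^ k * u))"
    and "\<bar>\<phi> u\<bar> \<le> 2 * (\<Sum>k. dev (lam ^ (k + m)))"
proof -
  have le: "\<bar>\<psi> (lam ^ k * u)\<bar> \<le> 2 * dev (lam ^ (k + m))" for k
  proof -
    have ku: "0 \<le> lam ^ k * u" "lam ^ k * u \<le> lam ^ (k + m)"
      using u lam_pos by (auto simp: power_add intro: mult_left_mono)
    have "lam ^ (k + m) \<le> lam ^ m"
      using lam_pos lam_less_1 by (intro power_decreasing) auto
    with ku have "dev (lam ^ k * u) \<le> 1 / 2" using m dev_mono[of "lam ^ k * u" "lam ^ m"] by linarith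
    with ku have "\<bar>\<psi> (lam ^ k * u)\<bar> \<le> 2 * dev (lam ^ k * u)" by (intro abs_cumulant_le_dev)
    also have "\<dots> \<le> 2 * dev (lam ^ (k + m))" using ku by (simp add: dev_mono)
    finally show ?thesis .
  qed
  have sum_dev: "summable (\<lambda>k. dev (lam ^ (k + m)))"
    using dev_summable by (subst summable_iff_shift)
  have abs: "summable (\<lambda>k. \<bar>\<psi> (lam ^ k * u)\<bar>)"
    by (rule summable_comparison_test'[of "\<lambda>k. 2 * dev (lam ^ (k + m))" 0])
       (use le sum_dev in \<open>auto simp: summable_mult\<close>)
  then show "summable (\<lambda>k. \<psi> (lam ^ k * u))" by (rule summable_rabs_cancel)
  have "\<bar>\<phi> u\<bar> \<le> (\<Sum>k. \<bar>\<psi> (lam ^ k * u)\<bar>)"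
    unfolding cumulant_series_def by (rule summable_rabs[OF abs])
  also have "\<dots> \<le> (\<Sum>k. 2 * dev (lam ^ (k + m)))"
    by (rule suminf_le[OF le abs]) (simp add: sum_dev summable_mult)
  also have "\<dots> = 2 * (\<Sum>k. dev (lam ^ (k + m)))" by (rule suminf_mult[OF sum_dev])
  finally show "\<bar>\<phi> u\<bar> \<le> 2 * (\<Sum>k. dev (lam ^ (k + m)))" .
qed

lemma dev_eventually_small: "eventually (\<lambda>m. dev (lam ^ m) \<le> 1 / 2) sequentially"
  by (rule eventually_mono[OF order_tendstoD(2)[OF summable_LIMSEQ_zero[OF dev_summable], of "1 / 2"]]) auto

lemma eventually_power_mult_le:
  assumes "0 < \<epsilon>"
  shows "\<exists>j. lam ^ j * u \<le> \<epsilon>"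
proof -
  have "(\<lambda>j. lam ^ j * u) \<longlonglongrightarrow> 0 * u"
    using lam_pos lam_less_1 by (intro tendsto_intros LIMSEQ_power_zero) auto
  then have "eventually (\<lambda>j. lam ^ j * u < \<epsilon>) sequentially"
    using assms by (intro order_tendstoD) auto
  then show ?thesis by (auto simp: eventually_sequentially intro: less_imp_le)
qed

text \<open>A shift of the index reduces an arbitrary \<open>u\<close> to the small arguments treated above.\<close>

lemma cumulant_series_summable:
  assumes "u \<ge> 0"
  shows "summable (\<lambda>k. \<psi> (lam ^ k * u))"
proof -
  obtain m where m: "dev (lam ^ m) \<le> 1 / 2"
    using dev_eventually_small by (auto simp: eventually_sequentially)
  obtain j where j: "lam ^ j * u \<le> lam ^ m"
    using eventually_power_mult_le[of "lam ^ m" u] lam_pos by auto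
  have "summable (\<lambda>k. \<psi> (lam ^ k * (lam ^ j * u)))"
    using assms lam_pos by (intro cumulant_series_small(1)[OF m _ j]) auto
  then have "summable (\<lambda>k. \<psi> (lam ^ (k + j) * u))" by (simp add: power_add mult.assoc)
  then show ?thesis by (subst (asm) summable_iff_shift)
qed

lemma cumulant_series_rec:
  assumes "u \<ge> 0"
  shows "\<phi> u = \<psi> u + \<phi> (lam * u)"
proof -
  have "(\<Sum>k. \<psi> (lam ^ Suc k * u)) = (\<Sum>k. \<psi> (lam ^ k * u)) - \<psi> (lam ^ 0 * u)"
    by (rule suminf_split_head[OF cumulant_series_summable[OF assms]])
  then show ?thesis unfolding cumulant_series_def by (simp add: mult.assoc mult.left_commute)
qed

lemma cumulant_series_tendsto_0: "(\<phi> \<longlongrightarrow> 0) (at_right 0)"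
proof (rule tendstoI)
  fix \<epsilon> :: real assume "\<epsilon> > 0"
  have "(\<lambda>m. \<Sum>k. dev (lam ^ (k + m))) \<longlonglongrightarrow> 0" 
    by (rule suminf_exist_split2[OF dev_summable])
  then have "eventually (\<lambda>m. (\<Sum>k. dev (lam ^ (k + m))) < \<epsilon> / 2) sequentially"
    using \<open>\<epsilon> > 0\<close> by (intro order_tendstoD) auto
  from eventually_happens'[OF _ eventually_conj[OF dev_eventually_small this]]
  obtain m where m: "dev (lam ^ m) \<le> 1 / 2" "(\<Sum>k. dev (lam ^ (k + m))) < \<epsilon> / 2"
    by auto
  have "dist (\<phi> u) 0 < \<epsilon>" if "0 < u" "u < lam ^ m" for u
    using cumulant_series_small(2)[OF m(1), of u] m(2) that by simp
  moreover have "0 < lam ^ m" using lam_pos by simp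
  ultimately show "eventually (\<lambda>u. dist (\<phi> u) 0 < \<epsilon>) (at_right 0)"
    by (auto simp: eventually_at_right_field)
qed

text \<open>Near 0 this follows from the limit there. The recursion \<open>\<phi> u = \<psi> u + \<phi> (lam * u)\<close> carries the bound
  outwards, as \<open>mgf\<close> is bounded below on bounded intervals.\<close>

lemma exp_neg_cumulant_series_bounded:
  "\<exists>C. \<forall>u\<in>{0..b}. exp (- \<phi> u) \<le> C"
proof -
  define c where "c = (\<integral>t. exp (- (\<bar>b\<bar> * \<bar>t\<bar>)) \<partial>\<mu>)"
  have c_int: "integrable \<mu> (\<lambda>t. exp (- (\<bar>b\<bar> * \<bar>t\<bar>)))"
    by (rule integrable_const_bound[of _ 1]) auto
  have c_pos: "0 < c" unfolding c_def
    by (rule integral_less_AE_space[of "\<lambda>_. 0", simplified])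
       (auto simp: c_int emeasure_space_1[simplified])
  have mgf_ge: "c \<le> mgf u" if "0 \<le> u" "u \<le> b" for u
    unfolding c_def
  proof (intro integral_mono c_int exp_integrable that, unfold exp_le_cancel_iff)
    fix t
    have "- (u * t) \<le> u * \<bar>t\<bar>" using that by (simp add: abs_if mult_nonneg_nonpos)
    also have "\<dots> \<le> \<bar>b\<bar> * \<bar>t\<bar>" using that by (intro mult_right_mono) auto
    finally show "- (\<bar>b\<bar> * \<bar>t\<bar>) \<le> u * t" by simp
  qed
  obtain m where m: "dev (lam ^ m) \<le> 1 / 2"
    using dev_eventually_small by (auto simp: eventually_sequentially)
  have bounded: "\<exists>C. \<forall>u. 0 \<le> u \<longrightarrow> u \<le> b \<longrightarrow> lam ^ j * u \<le> lam ^ m \<longrightarrow> exp (- \<phi> u) \<le> C" for j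
  proof (induction j)
    case 0
    then show ?case
      using cumulant_series_small(2)[OF m]
      by (intro exI[of _ "exp (2 * (\<Sum>k. dev (lam ^ (k + m))))"]) (auto simp: abs_le_iff)
  next
    case (Suc j)
    then obtain C where C: "\<And>u. 0 \<le> u \<Longrightarrow> u \<le> b \<Longrightarrow> lam ^ j * u \<le> lam ^ m \<Longrightarrow> exp (- \<phi> u) \<le> C"
      by blast
    have "exp (- \<phi> u) \<le> C / c" if u: "0 \<le> u" "u \<le> b" "lam ^ Suc j * u \<le> lam ^ m" for u
    proof -
      have lu: "0 \<le> lam * u" "lam * u \<le> u"
        using u lam_pos lam_less_1 by (auto simp: mult_left_le_one_le)
      have "exp (- \<phi> u) = exp (- \<phi> (lam * u)) / mgf u"
        using mgf_pos[OF u(1)]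
        by (simp add: cumulant_series_rec[OF u(1)] exp_diff exp_minus exp_add cumulant_def field_simps)
      also have "\<dots> \<le> C / c"
        using C[of "lam * u"] lu u mgf_ge[OF u(1,2)] c_pos
        by (intro frac_le) (auto simp: ac_simps intro: order_trans[OF exp_ge_zero])
      finally show ?thesis .
    qed
    then show ?case by blast
  qed
  obtain j where j: "lam ^ j * b \<le> lam ^ m"
    using eventually_power_mult_le[of "lam ^ m" b] lam_pos by auto
  have ju: "lam ^ j * u \<le> lam ^ m" if "u \<le> b" for u
    by (rule order_trans[OF _ j]) (use that lam_pos in simp)
  obtain C where "\<forall>u. 0 \<le> u \<longrightarrow> u \<le> b \<longrightarrow> lam ^ j * u \<le> lam ^ m \<longrightarrow> exp (- \<phi> u) \<le> C"
    using bounded[of j] by (elim exE)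
  with ju show ?thesis by (intro exI[of _ C] ballI) simp
qed

lemma cumulant_measurable [measurable]: "\<psi> \<in> borel_measurable borel"
  unfolding cumulant_def by measurable

lemma cumulant_series_measurable [measurable]: "\<phi> \<in> borel_measurable borel"
  unfolding cumulant_series_def by measurable

lemma dev_measurable [measurable]: "dev \<in> borel_measurable borel"
  unfolding dev_def by measurable

end

section \<open>A Frullani integral\<close>

lemma integral_inverse_Ioc:
  fixes a :: real
  assumes "0 < a" "a < 1"
  shows "(LINT s|lborel. indicator {a<..1} s * (L / s)) = L * ln (1 / a)"
proof -
  have "(LINT s|lborel. indicator {a<..1} s * (L / s)) = (LINT s|lborel. (L / s) * indicator {a..1} s)"
    using AE_lborel_singleton[of a]
    by (intro integral_cong_AE) (auto simp: indicator_def elim!: eventually_mono)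
  also have "\<dots> = L * ln 1 - L * ln a"
    using assms
    by (intro integral_FTC_Icc_real)
       (auto intro!: derivative_eq_intros continuous_intros simp: has_real_derivative_iff_has_vector_derivative[symmetric])
  finally show ?thesis using assms by (simp add: ln_div)
qed

text \<open>Integrability of \<open>f u / u\<close> at infinity replaces a limit of \<open>f\<close> there and makes the boundary term at
  infinity vanish. Cut off at \<open>\<delta>\<close>, the integral is that of \<open>f v / v\<close> over \<open>(a * \<delta>, \<delta>]\<close>, hence of
  \<open>f (\<delta> * s) / s\<close> over \<open>(a, 1]\<close>.\<close>

lemma frullani_integral:
  fixes f :: "real \<Rightarrow> real"
  assumes f [measurable]: "f \<in> borel_measurable borel"
    and a: "0 < a" "a < 1"
    and tail: "\<And>\<delta>. \<delta> > 0 \<Longrightarrow> set_integrable lborel {\<delta><..} (\<lambda>u. f u / u)"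
    and lim: "(f \<longlongrightarrow> L) (at_right 0)"
    and int: "set_integrable lborel {0<..} (\<lambda>u. (f (a * u) - f u) / u)"
  shows "(LBINT u:{0<..}. (f (a * u) - f u) / u) = L * ln (1 / a)"
proof -
  let ?d = "\<lambda>u. (f (a * u) - f u) / u"
  have rescaled: "(LBINT u:{\<delta><..}. ?d u) = (LINT s|lborel. indicator {a<..1} s * (f (\<delta> * s) / s))"
    if "\<delta> > 0" for \<delta>
  proof -
    have int_a: "integrable lborel (\<lambda>v. indicator {a * \<delta><..} v * (f v / v))"
      using tail[of "a * \<delta>"] a that by (simp add: set_integrable_def)
    have int_1: "integrable lborel (\<lambda>v. indicator {\<delta><..} v * (f v / v))"
      using tail[of \<delta>] that by (simp add: set_integrable_def)
    have eq: "a * (indicator {a * \<delta><..} (0 + a * u) * (f (0 + a * u) / (0 + a * u)))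
        = indicator {\<delta><..} u * (f (a * u) / u)" for u
      using a by (auto simp: indicator_def)
    have int_a': "integrable lborel (\<lambda>u. indicator {\<delta><..} u * (f (a * u) / u))"
      using integrable_mult_right[OF lborel_integrable_real_affine[OF int_a, of a 0], of a] a
      unfolding eq by simp
    have "(LINT v|lborel. indicator {a * \<delta><..} v * (f v / v))
        = a * (LINT u|lborel. indicator {a * \<delta><..} (0 + a * u) * (f (0 + a * u) / (0 + a * u)))"
      using lborel_integral_real_affine[of a "\<lambda>v. indicator {a * \<delta><..} v * (f v / v)" 0] a by simp
    also have "\<dots> = (LINT u|lborel. indicator {\<delta><..} u * (f (a * u) / u))"
      by (simp only: eq flip: integral_mult_right_zero)
    finally have scale: "(LINT u|lborel. indicator {\<delta><..} u * (f (a * u) / u))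
        = (LINT v|lborel. indicator {a * \<delta><..} v * (f v / v))" ..
    have "(LBINT u:{\<delta><..}. ?d u)
        = (LINT u|lborel. indicator {\<delta><..} u * (f (a * u) / u) - indicator {\<delta><..} u * (f u / u))"
      unfolding set_lebesgue_integral_def
      by (intro Bochner_Integration.integral_cong) (auto simp: diff_divide_distrib algebra_simps)
    also have "\<dots> = (LINT v|lborel. indicator {a * \<delta><..} v * (f v / v) - indicator {\<delta><..} v * (f v / v))"
      by (simp only: Bochner_Integration.integral_diff[OF int_a' int_1]
          Bochner_Integration.integral_diff[OF int_a int_1] scale)
    also have "\<dots> = (LINT v|lborel. indicator {a * \<delta><..\<delta>} v * (f v / v))"
      using less_trans[OF mult_strict_right_mono[OF a(2) that]]
      by (intro Bochner_Integration.integral_cong) (auto simp: indicator_def)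
    also have "\<dots> = (LINT s|lborel. \<delta> * (indicator {a * \<delta><..\<delta>} (0 + \<delta> * s) * (f (0 + \<delta> * s) / (0 + \<delta> * s))))"
      by (subst integral_mult_right_zero)
         (use lborel_integral_real_affine[of \<delta> "\<lambda>v. indicator {a * \<delta><..\<delta>} v * (f v / v)" 0] that in simp)
    also have "\<dots> = (LINT s|lborel. indicator {a<..1} s * (f (\<delta> * s) / s))"
      using that by (intro Bochner_Integration.integral_cong) (auto simp: indicator_def)
    finally show ?thesis .
  qed
  have "eventually (\<lambda>u. \<bar>f u - L\<bar> < 1) (at_right 0)"
    using tendstoD[OF lim, of 1] by (simp add: dist_real_def)
  then obtain b where b: "b > 0" "\<And>u. 0 < u \<Longrightarrow> u < b \<Longrightarrow> \<bar>f u - L\<bar> < 1"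
    by (auto simp: eventually_at_right_field)
  \<comment> \<open>Cut-offs decreasing to 0 inside the range where \<open>f\<close> is bounded, for dominated convergence.\<close>
  define \<delta> where "\<delta> n = b * a ^ Suc n" for n
  have \<delta>: "0 < \<delta> n" "\<delta> n < b" for n
    using b a power_Suc_less_one[of a n] by (auto simp: \<delta>_def)
  have "(\<lambda>n. b * (a * a ^ n)) \<longlonglongrightarrow> b * (a * 0)"
    using a by (intro tendsto_intros LIMSEQ_power_zero) auto
  then have \<delta>_lim: "\<delta> \<longlonglongrightarrow> 0" by (simp add: \<delta>_def[abs_def])
  have lim_delta: "(\<lambda>n. LBINT u:{\<delta> n<..}. ?d u) \<longlonglongrightarrow> (LBINT u:{0<..}. ?d u)"
    unfolding set_lebesgue_integral_def
  proof (rule integral_dominated_convergence)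
    show "integrable lborel (\<lambda>u. norm (indicator {0<..} u *\<^sub>R ?d u))"
      using int unfolding set_integrable_def by (rule integrable_norm)
    show "AE u in lborel. (\<lambda>n. indicator {\<delta> n<..} u *\<^sub>R ?d u) \<longlonglongrightarrow> indicator {0<..} u *\<^sub>R ?d u"
    proof (intro AE_I2 tendsto_eventually)
      fix u :: real
      show "eventually (\<lambda>n. indicator {\<delta> n<..} u *\<^sub>R ?d u = indicator {0<..} u *\<^sub>R ?d u) sequentially"
      proof (cases "u > 0")
        case True
        from order_tendstoD(2)[OF \<delta>_lim True] show ?thesis
          by eventually_elim (use True in simp)
      next
        case False
        then have "\<not> \<delta> n < u" for n using \<delta>(1)[of n] by linarith
        with False show ?thesis by simp
      qed
    qed
    show "AE u in lborel. norm (indicator {\<delta> n<..} u *\<^sub>R ?d u) \<le> norm (indicator {0<..} u *\<^sub>R ?d u)" for n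
      using \<delta>(1)[of n] by (auto simp: indicator_def)
  qed measurable
  have lim_rescaled: "(\<lambda>n. LINT s|lborel. indicator {a<..1} s * (f (\<delta> n * s) / s))
      \<longlonglongrightarrow> (LINT s|lborel. indicator {a<..1} s * (L / s))"
  proof (rule integral_dominated_convergence)
    have "integrable lborel (\<lambda>s. indicator {a..1} s *\<^sub>R ((\<bar>L\<bar> + 1) / a))"
      by (intro integrable_scaleR_left integrable_real_indicator) (simp_all add: emeasure_lborel_Icc_eq)
    then show "integrable lborel (\<lambda>s. indicator {a..1} s * ((\<bar>L\<bar> + 1) / a))" by simp
    show "AE s in lborel. (\<lambda>n. indicator {a<..1} s * (f (\<delta> n * s) / s)) \<longlonglongrightarrow> indicator {a<..1} s * (L / s)"
    proof (rule AE_I2)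
      fix s :: real
      show "(\<lambda>n. indicator {a<..1} s * (f (\<delta> n * s) / s)) \<longlonglongrightarrow> indicator {a<..1} s * (L / s)"
      proof (cases "s \<in> {a<..1}")
        case True
        then have s: "s > 0" using a by simp
        have "(\<lambda>n. \<delta> n * s) \<longlonglongrightarrow> 0" using tendsto_mult_left_zero[OF \<delta>_lim] .
        then have "filterlim (\<lambda>n. \<delta> n * s) (at_right 0) sequentially"
          using \<delta>(1) s by (auto simp: filterlim_at less_imp_neq[OF \<delta>(1), THEN not_sym] intro!: always_eventually)
        from filterlim_compose[OF lim this] s show ?thesis
          by (intro tendsto_intros) auto
      qed simp
    qed
    show "AE s in lborel. norm (indicator {a<..1} s * (f (\<delta> n * s) / s)) \<le> indicator {a..1} s * ((\<bar>L\<bar> + 1) / a)" for n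
    proof (rule AE_I2)
      fix s :: real
      show "norm (indicator {a<..1} s * (f (\<delta> n * s) / s)) \<le> indicator {a..1} s * ((\<bar>L\<bar> + 1) / a)"
      proof (cases "s \<in> {a<..1}")
        case True
        then have s: "a < s" "s \<le> 1" by auto
        have "\<delta> n * s \<le> \<delta> n" using s \<delta>(1)[of n] by simp
        then have "\<delta> n * s < b" using \<delta>(2)[of n] by (rule le_less_trans)
        moreover have "0 < \<delta> n * s" using \<delta>(1)[of n] s a by simp
        ultimately have "0 < \<delta> n * s" "\<delta> n * s < b" by auto
        from b(2)[OF this] have "\<bar>f (\<delta> n * s)\<bar> \<le> \<bar>L\<bar> + 1" by linarith
        then have "\<bar>f (\<delta> n * s)\<bar> / s \<le> (\<bar>L\<bar> + 1) / a"
          using s a by (intro frac_le) auto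
        then show ?thesis using s a by (simp add: indicator_def)
      next
        case False
        then show ?thesis using a by (simp add: indicator_def)
      qed
    qed
  qed measurable
  have "(LBINT u:{0<..}. ?d u) = (LINT s|lborel. indicator {a<..1} s * (L / s))"
    by (rule LIMSEQ_unique[OF lim_delta[unfolded rescaled[OF \<delta>(1)]] lim_rescaled])
  then show ?thesis using integral_inverse_Ioc[OF a] by simp
qed

section \<open>One step of the chain\<close>

text \<open>The integrability hypotheses are imposed at a single point \<open>x\<close>. They only serve to make
  \<open>exp (- \<phi> u) / u\<close> integrable at infinity and the absolute version \<open>abs_H\<close> of \<open>H\<close> finite at \<open>x\<close>.\<close>

locale integrable_innovation_law = innovation_law +
  fixes x :: real
  assumes int_x: "set_integrable lborel {1..} (\<lambda>u. exp (u * x - \<phi> u) / u)"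
    and int_H_x: "set_integrable lborel {0<..} (H_integrand \<phi> x)"
begin

text \<open>The function against which \<open>exp (u * y) - 1\<close> is integrated in \<open>H\<close>.\<close>

abbreviation weight :: "real \<Rightarrow> real" where
  "weight u \<equiv> exp (- \<phi> u) / u"

text \<open>On \<open>[1, \<infinity>)\<close> the weight is the difference of the two functions assumed integrable at \<open>x\<close>.\<close>

lemma weight_integrable:
  assumes "\<delta> > 0"
  shows "set_integrable lborel {\<delta><..} weight"
proof -
  have "set_integrable lborel {1..} (H_integrand \<phi> x)"
    by (rule set_integrable_subset[OF int_H_x]) auto
  from set_integral_diff(1)[OF int_x this]
  have "set_integrable lborel {1..} (\<lambda>u. exp (u * x - \<phi> u) / u - H_integrand \<phi> x u)" .
  also have "(\<lambda>u. exp (u * x - \<phi> u) / u - H_integrand \<phi> x u) = weight"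
  proof
    show "exp (u * x - \<phi> u) / u - H_integrand \<phi> x u = weight u" for u
      using exp_add[of "u * x" "- \<phi> u"]
      by (simp add: H_integrand_def algebra_simps diff_divide_distrib)
  qed
  finally have large: "set_integrable lborel {1..} weight" .
  obtain C where C: "\<And>u. u \<in> {0..1} \<Longrightarrow> exp (- \<phi> u) \<le> C"
    using exp_neg_cumulant_series_bounded by blast
  have "0 \<le> C" using C[of 0] by (auto intro: order_trans[OF exp_ge_zero])
  have small: "set_integrable lborel {\<delta>..1} weight"
    unfolding set_integrable_def
  proof (rule Bochner_Integration.integrable_bound)
    show "integrable lborel (\<lambda>u. indicator {\<delta>..1} u *\<^sub>R (C / \<delta>))"
      by (intro integrable_scaleR_left integrable_real_indicator) (simp_all add: emeasure_lborel_Icc_eq)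
    show "AE u in lborel. norm (indicator {\<delta>..1} u *\<^sub>R weight u) \<le> norm (indicator {\<delta>..1} u *\<^sub>R (C / \<delta>))"
    proof (rule AE_I2)
      fix u :: real
      show "norm (indicator {\<delta>..1} u *\<^sub>R weight u) \<le> norm (indicator {\<delta>..1} u *\<^sub>R (C / \<delta>))"
        using C[of u] assms \<open>0 \<le> C\<close> by (auto simp: indicator_def intro!: frac_le)
    qed
  qed measurable
  show ?thesis
    by (rule set_integrable_subset[OF set_integrable_Un[OF small large]]) auto
qed

lemma abs_H_integrand:
  "u > 0 \<Longrightarrow> \<bar>H_integrand \<phi> y u\<bar> = \<bar>exp (u * y) - 1\<bar> * weight u"
  by (simp add: H_integrand_def abs_mult)

text \<open>The integral of the absolute value of the integrand of \<open>H\<close>, without the normalising factor. It is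
  infinite exactly where \<open>H\<close> is not defined by an absolutely convergent integral.\<close>

definition abs_H :: "real \<Rightarrow> ennreal" where
  "abs_H y = (\<integral>\<^sup>+u. ennreal \<bar>indicator {0<..} u * H_integrand \<phi> y u\<bar> \<partial>lborel)"

lemma abs_H_measurable [measurable]: "abs_H \<in> borel_measurable borel"
  unfolding abs_H_def H_integrand_def by measurable

lemma H_fun_measurable [measurable]: "H_fun lam \<phi> \<in> borel_measurable borel"
  unfolding H_fun_def H_integrand_def set_lebesgue_integral_def by measurable

lemma abs_H_finite_iff: "abs_H y < \<infinity> \<longleftrightarrow> set_integrable lborel {0<..} (H_integrand \<phi> y)"
  unfolding abs_H_def set_integrable_def integrable_iff_bounded H_integrand_def by simp

lemma abs_H_x_finite: "abs_H x < \<infinity>"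
  using int_H_x unfolding abs_H_finite_iff .

lemma log_inverse_lam_pos: "0 < ln (1 / lam)"
  using lam_pos lam_less_1 by simp

lemma abs_H_fun_le: "ennreal \<bar>H_fun lam \<phi> y\<bar> \<le> ennreal (1 / ln (1 / lam)) * abs_H y"
proof -
  have "ennreal \<bar>LBINT u:{0<..}. H_integrand \<phi> y u\<bar> \<le> abs_H y"
  proof (cases "set_integrable lborel {0<..} (H_integrand \<phi> y)")
    case True
    from integral_norm_bound_ennreal[OF True[unfolded set_integrable_def]] show ?thesis
      by (simp add: abs_H_def set_lebesgue_integral_def)
  next
    case False
    then show ?thesis
      by (simp add: set_integrable_def set_lebesgue_integral_def not_integrable_integral_eq)
  qed
  then have "ennreal (1 / ln (1 / lam)) * ennreal \<bar>LBINT u:{0<..}. H_integrand \<phi> y u\<bar>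
      \<le> ennreal (1 / ln (1 / lam)) * abs_H y"
    by (rule mult_left_mono) simp
  moreover have "\<bar>H_fun lam \<phi> y\<bar> = 1 / ln (1 / lam) * \<bar>LBINT u:{0<..}. H_integrand \<phi> y u\<bar>"
    using log_inverse_lam_pos unfolding H_fun_def by (simp only: abs_mult) simp
  ultimately show ?thesis
    using log_inverse_lam_pos by (simp add: ennreal_mult[symmetric])
qed

text \<open>By monotonicity of \<open>dev\<close>, comparison on the intervals \<open>(lam ^ Suc k, lam ^ k]\<close> turns the
  summability of \<open>dev (lam ^ k)\<close> into integrability of \<open>dev u / u\<close> at 0.\<close>

lemma dev_over_id_integrable: "(\<integral>\<^sup>+u\<in>{0<..1}. ennreal (dev u / u) \<partial>lborel) < \<infinity>"
proof -
  let ?c = "\<lambda>k. dev (lam ^ k) / lam ^ Suc k"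
  let ?I = "\<lambda>k. {lam ^ Suc k<..lam ^ k}"
  have bound: "ennreal (dev u / u) * indicator {0<..1} u \<le> (\<Sum>k. ennreal (?c k) * indicator (?I k) u)" for u
  proof (cases "u \<in> {0<..1}")
    case True
    have "\<exists>k. lam ^ k < u"
    proof -
      obtain k where "lam ^ k * 1 \<le> u / 2" using eventually_power_mult_le[of "u / 2" 1] True by auto
      with True have "lam ^ k < u" by simp
      then show ?thesis ..
    qed
    define n where "n = (LEAST k. lam ^ k < u)"
    have n: "lam ^ n < u" unfolding n_def by (rule LeastI_ex[OF \<open>\<exists>k. lam ^ k < u\<close>])
    have "n \<noteq> 0" using n True by (auto intro: ccontr)
    then obtain k where k: "n = Suc k" using not0_implies_Suc by blast
    have "\<not> lam ^ k < u" using not_less_Least[of k "\<lambda>k. lam ^ k < u"] k by (simp add: n_def)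
    with n k have uk: "u \<in> ?I k" by simp
    then have "dev u / u \<le> ?c k"
      using True lam_pos by (intro frac_le dev_mono) (auto simp: dev_nonneg)
    then have "ennreal (dev u / u) * indicator {0<..1} u \<le> ennreal (?c k) * indicator (?I k) u"
      using True uk by (simp add: ennreal_leI)
    also have "\<dots> \<le> (\<Sum>k. ennreal (?c k) * indicator (?I k) u)"
    proof -
      define g :: "nat \<Rightarrow> ennreal" where "g k = ennreal (?c k) * indicator (?I k) u" for k
      have "g k \<le> (\<Sum>k. g k)" using sum_le_suminf[of g "{k}"] by simp
      then show ?thesis unfolding g_def .
    qed
    finally show ?thesis .
  qed simp
  have "(\<integral>\<^sup>+u\<in>{0<..1}. ennreal (dev u / u) \<partial>lborel)
      \<le> (\<integral>\<^sup>+u. (\<Sum>k. ennreal (?c k) * indicator (?I k) u) \<partial>lborel)"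
    by (intro nn_integral_mono bound)
  also have "\<dots> = (\<Sum>k. \<integral>\<^sup>+u. ennreal (?c k) * indicator (?I k) u \<partial>lborel)"
    by (rule nn_integral_suminf) measurable
  also have "\<dots> = (\<Sum>k. ennreal ((1 / lam - 1) * dev (lam ^ k)))"
  proof (rule arg_cong[where f = suminf], rule ext)
    fix k
    have "lam ^ Suc k \<le> lam ^ k" using lam_pos lam_less_1 by (intro power_decreasing) auto
    then have "(\<integral>\<^sup>+u. ennreal (?c k) * indicator (?I k) u \<partial>lborel) = ennreal (?c k) * ennreal (lam ^ k - lam ^ Suc k)"
      by (subst nn_integral_cmult_indicator) simp_all
    also have "\<dots> = ennreal (?c k * (lam ^ k - lam ^ Suc k))"
      using lam_pos by (intro ennreal_mult'[symmetric]) (simp add: dev_nonneg)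
    also have "?c k * (lam ^ k - lam ^ Suc k) = (1 / lam - 1) * dev (lam ^ k)"
      using lam_pos by (simp add: field_simps)
    finally show "(\<integral>\<^sup>+u. ennreal (?c k) * indicator (?I k) u \<partial>lborel) = ennreal ((1 / lam - 1) * dev (lam ^ k))" .
  qed
  also have "\<dots> = ennreal (\<Sum>k. (1 / lam - 1) * dev (lam ^ k))"
    using lam_pos lam_less_1
    by (intro suminf_ennreal2 summable_mult dev_summable) (simp add: dev_nonneg)
  also have "\<dots> < \<infinity>" by simp
  finally show ?thesis .
qed

text \<open>One step of the chain produces a factor \<open>mgf u\<close>, which \<open>exp (- \<phi> u)\<close> absorbs by rescaling \<open>u\<close>: this
  is where the special form of \<open>\<phi>\<close> enters.\<close>

lemma mgf_mult_exp_neg_cumulant_series: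
  assumes "u > 0"
  shows "mgf u * exp (- \<phi> u) = exp (- \<phi> (lam * u))"
  using mgf_pos[of u] assms
  by (simp add: cumulant_series_rec[of u] exp_diff exp_minus exp_add cumulant_def field_simps)

lemma shift_exp_integrable:
  assumes "u \<ge> 0"
  shows "integrable \<mu> (\<lambda>t. exp (u * (lam * y + t)))"
  using integrable_mult_right[OF exp_integrable[OF assms], of "exp (u * (lam * y))"]
  by (simp add: exp_add distrib_left)

lemma shift_exp_mean: "(\<integral>t. exp (u * (lam * y + t)) \<partial>\<mu>) = exp (lam * u * y) * mgf u"
  by (simp add: exp_add distrib_left ac_simps)

text \<open>The deviation from 1 of \<open>exp (u * Y)\<close>, where \<open>Y\<close> is the position one step after \<open>y\<close>.\<close>

lemma step_deviation_small:
  assumes "0 < u" "u \<le> 1"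
  shows "(\<integral>t. \<bar>exp (u * (lam * y + t)) - 1\<bar> \<partial>\<mu>) \<le> dev u + (1 + dev 1) * \<bar>exp (u * y) - 1\<bar>"
proof -
  let ?e = "\<bar>exp (u * y) - 1\<bar>"
  have e: "\<bar>exp (u * (lam * y)) - 1\<bar> \<le> ?e"
    using abs_exp_minus_one_mono[of "lam * u" u y] assms lam_pos lam_less_1
    by (simp add: ac_simps mult_left_le_one_le)
  then have e': "exp (u * (lam * y)) \<le> 1 + ?e" by linarith
  have pointwise: "\<bar>exp (u * (lam * y + t)) - 1\<bar> \<le> (1 + ?e) * \<bar>exp (u * t) - 1\<bar> + ?e" for t
  proof -
    have "exp (u * (lam * y + t)) - 1 = exp (u * (lam * y)) * (exp (u * t) - 1) + (exp (u * (lam * y)) - 1)"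
      by (simp add: distrib_left exp_add algebra_simps)
    then have "\<bar>exp (u * (lam * y + t)) - 1\<bar>
        \<le> \<bar>exp (u * (lam * y)) * (exp (u * t) - 1)\<bar> + \<bar>exp (u * (lam * y)) - 1\<bar>"
      by (simp only: abs_triangle_ineq)
    also have "\<bar>exp (u * (lam * y)) * (exp (u * t) - 1)\<bar> \<le> (1 + ?e) * \<bar>exp (u * t) - 1\<bar>"
      using e' by (simp add: abs_mult mult_right_mono)
    finally show ?thesis using e by linarith
  qed
  have int: "integrable \<mu> (\<lambda>t. \<bar>exp (u * t) - 1\<bar>)" using assms by (intro dev_integrable) simp
  have "(\<integral>t. \<bar>exp (u * (lam * y + t)) - 1\<bar> \<partial>\<mu>) \<le> (\<integral>t. (1 + ?e) * \<bar>exp (u * t) - 1\<bar> + ?e \<partial>\<mu>)"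
    using assms int shift_exp_integrable[of u y]
    by (intro integral_mono pointwise) (auto intro!: Bochner_Integration.integrable_add)
  also have "\<dots> = (1 + ?e) * dev u + ?e"
    using int by (simp add: dev_def prob_space[simplified])
  also have "\<dots> \<le> dev u + (1 + dev 1) * ?e"
    using mult_left_mono[OF dev_mono[of u 1], of ?e] assms by (simp add: algebra_simps)
  finally show ?thesis .
qed

lemma step_deviation_large:
  assumes "0 < u"
  shows "(\<integral>t. \<bar>exp (u * (lam * y + t)) - 1\<bar> \<partial>\<mu>) * weight u
    \<le> lam * (\<bar>H_integrand \<phi> y (lam * u)\<bar> + weight (lam * u)) + weight u"
proof -
  let ?v = "lam * u"
  have v: "0 < ?v" using assms lam_pos by simp
  have "(\<integral>t. \<bar>exp (u * (lam * y + t)) - 1\<bar> \<partial>\<mu>) \<le> (\<integral>t. exp (u * (lam * y + t)) + 1 \<partial>\<mu>)"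
    using shift_exp_integrable[of u y] assms
    by (intro integral_mono) (auto simp: abs_le_iff intro: order_trans[OF _ less_imp_le[OF exp_gt_zero]])
  also have "\<dots> = exp (?v * y) * mgf u + 1"
    using shift_exp_integrable[of u y] assms by (simp add: shift_exp_mean prob_space[simplified])
  finally have "(\<integral>t. \<bar>exp (u * (lam * y + t)) - 1\<bar> \<partial>\<mu>) * weight u \<le> (exp (?v * y) * mgf u + 1) * weight u"
    using assms by (intro mult_right_mono) auto
  also have "\<dots> = exp (?v * y) * (mgf u * exp (- \<phi> u)) / u + weight u"
    by (simp add: algebra_simps add_divide_distrib)
  also have "\<dots> = lam * (exp (?v * y) * weight ?v) + weight u"
    using assms lam_pos by (simp add: mgf_mult_exp_neg_cumulant_series)
  also have "\<dots> \<le> lam * ((\<bar>exp (?v * y) - 1\<bar> + 1) * weight ?v) + weight u"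
    using v lam_pos by (intro add_right_mono mult_left_mono mult_right_mono) auto
  also have "(\<bar>exp (?v * y) - 1\<bar> + 1) * weight ?v = \<bar>H_integrand \<phi> y ?v\<bar> + weight ?v"
    by (simp only: abs_H_integrand[OF v] distrib_right mult_1)
  finally show ?thesis .
qed

text \<open>The mean of \<open>abs_H\<close> after one step from \<open>y\<close> is bounded by an affine function of \<open>abs_H y\<close>, with
  constants that do not depend on \<open>y\<close>; this bound can therefore be iterated along the chain. On \<open>(0, 1]\<close> the
  integrand is controlled through \<open>dev\<close>, on \<open>(1, \<infinity>)\<close> through \<open>mgf_mult_exp_neg_cumulant_series\<close> and the substitution
  \<open>v = lam * u\<close>.\<close>

lemma abs_H_step_le:
  "\<exists>C1 C2. \<forall>y. (\<integral>\<^sup>+t. abs_H (lam * y + t) \<partial>\<mu>) \<le> ennreal C1 + ennreal C2 * abs_H y"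
proof -
  interpret pair_sigma_finite \<mu> "lborel :: real measure" ..
  obtain C where C: "\<And>u. u \<in> {0..1} \<Longrightarrow> exp (- \<phi> u) \<le> C"
    using exp_neg_cumulant_series_bounded by blast
  have "0 \<le> C" using C[of 0] by (auto intro: order_trans[OF exp_ge_zero])
  let ?w = "\<lambda>\<delta>. \<integral>\<^sup>+u\<in>{\<delta><..}. ennreal (weight u) \<partial>lborel"
  have w: "?w \<delta> < \<infinity>" if "\<delta> > 0" for \<delta>
  proof -
    have "?w \<delta> = (\<integral>\<^sup>+u. ennreal (norm (indicator {\<delta><..} u *\<^sub>R weight u)) \<partial>lborel)"
      using that by (intro nn_integral_cong) (auto simp: indicator_def)
    also have "\<dots> < \<infinity>"
      using weight_integrable[OF that] unfolding set_integrable_def integrable_iff_bounded by simp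
    finally show ?thesis .
  qed
  let ?J = "\<integral>\<^sup>+u\<in>{0<..1}. ennreal (dev u / u) \<partial>lborel"
  let ?c = "1 + dev 1"
  define D where "D y u = (\<integral>t. \<bar>exp (u * (lam * y + t)) - 1\<bar> \<partial>\<mu>)" for y u
  have D_meas [measurable]: "D y \<in> borel_measurable borel" for y
    unfolding D_def by measurable
  have step: "(\<integral>\<^sup>+t. abs_H (lam * y + t) \<partial>\<mu>) \<le> (ennreal C * ?J + ?w lam + ?w 1) + ennreal (?c + 1) * abs_H y" for y
  proof -
    let ?h = "\<lambda>u. \<bar>indicator {0<..} u * H_integrand \<phi> y u\<bar>"
    have [measurable]: "?h \<in> borel_measurable borel" "H_integrand \<phi> y \<in> borel_measurable borel"
      unfolding H_integrand_def by measurable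
    have "(\<integral>\<^sup>+t. abs_H (lam * y + t) \<partial>\<mu>)
        = (\<integral>\<^sup>+u. (\<integral>\<^sup>+t. ennreal \<bar>indicator {0<..} u * H_integrand \<phi> (lam * y + t) u\<bar> \<partial>\<mu>) \<partial>lborel)"
      unfolding abs_H_def H_integrand_def by (intro Fubini'[symmetric]) measurable
    also have "\<dots> = (\<integral>\<^sup>+u. ennreal (D y u * weight u) * indicator {0<..} u \<partial>lborel)"
    proof (intro nn_integral_cong)
      fix u :: real
      show "(\<integral>\<^sup>+t. ennreal \<bar>indicator {0<..} u * H_integrand \<phi> (lam * y + t) u\<bar> \<partial>\<mu>)
          = ennreal (D y u * weight u) * indicator {0<..} u"
      proof (cases "u > 0")
        case True
        have int: "integrable \<mu> (\<lambda>t. \<bar>exp (u * (lam * y + t)) - 1\<bar> * weight u)"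
          using shift_exp_integrable[of u y] True by auto
        have "(\<integral>\<^sup>+t. ennreal \<bar>indicator {0<..} u * H_integrand \<phi> (lam * y + t) u\<bar> \<partial>\<mu>)
            = (\<integral>\<^sup>+t. ennreal (\<bar>exp (u * (lam * y + t)) - 1\<bar> * weight u) \<partial>\<mu>)"
          using True by (intro nn_integral_cong) (simp add: H_integrand_def abs_mult)
        also have "\<dots> = ennreal (\<integral>t. \<bar>exp (u * (lam * y + t)) - 1\<bar> * weight u \<partial>\<mu>)"
          using True by (intro nn_integral_eq_integral int) auto
        also have "(\<integral>t. \<bar>exp (u * (lam * y + t)) - 1\<bar> * weight u \<partial>\<mu>) = D y u * weight u"
          unfolding D_def by (rule integral_mult_left_zero)
        finally show ?thesis using True by simp
      qed simp
    qed
    \<comment> \<open>Arguments \<open>0 + lam * u\<close> keep the shape of the affine substitution rule applied below.\<close>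
    also have "\<dots> \<le> (\<integral>\<^sup>+u. ennreal C * (ennreal (dev u / u) * indicator {0<..1} u) + ennreal ?c * ennreal (?h u)
        + (ennreal lam * (ennreal (?h (0 + lam * u)) + ennreal (weight (0 + lam * u)) * indicator {lam<..} (0 + lam * u))
        + ennreal (weight u) * indicator {1<..} u) \<partial>lborel)"
    proof (intro nn_integral_mono)
      fix u :: real
      consider "u \<le> 0" | "0 < u" "u \<le> 1" | "1 < u" by linarith
      then show "ennreal (D y u * weight u) * indicator {0<..} u
        \<le> ennreal C * (ennreal (dev u / u) * indicator {0<..1} u) + ennreal ?c * ennreal (?h u)
          + (ennreal lam * (ennreal (?h (0 + lam * u)) + ennreal (weight (0 + lam * u)) * indicator {lam<..} (0 + lam * u))
          + ennreal (weight u) * indicator {1<..} u)"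
      proof cases
        case 2
        have "D y u * weight u \<le> (dev u + ?c * \<bar>exp (u * y) - 1\<bar>) * weight u"
          using step_deviation_small[OF 2] 2 unfolding D_def by (intro mult_right_mono) auto
        also have "\<dots> = exp (- \<phi> u) * (dev u / u) + ?c * ?h u"
        proof -
          have "?h u = \<bar>exp (u * y) - 1\<bar> * weight u" using abs_H_integrand[of u y] 2 by simp
          then show ?thesis by (simp only:) (use 2 in \<open>simp add: field_simps\<close>)
        qed
        also have "\<dots> \<le> C * (dev u / u) + ?c * ?h u"
          using 2 C[of u] dev_nonneg[of u] by (intro add_right_mono mult_right_mono) auto
        finally have "ennreal (D y u * weight u) \<le> ennreal (C * (dev u / u) + ?c * ?h u)"
          by (rule ennreal_leI)
        also have "\<dots> = ennreal C * ennreal (dev u / u) + ennreal ?c * ennreal (?h u)"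
          using 2 \<open>0 \<le> C\<close> dev_nonneg[of u] dev_nonneg[of 1]
          by (simp add: ennreal_plus ennreal_mult del: times_divide_eq_right)
        finally show ?thesis using 2 by (simp add: add_increasing2)
      next
        case 3
        have "D y u * weight u \<le> lam * (?h (lam * u) + weight (lam * u)) + weight u"
          using step_deviation_large[of u y] 3 lam_pos unfolding D_def by simp
        then have "ennreal (D y u * weight u) \<le> ennreal (lam * (?h (lam * u) + weight (lam * u)) + weight u)"
          by (rule ennreal_leI)
        also have "\<dots> = ennreal lam * (ennreal (?h (lam * u)) + ennreal (weight (lam * u))) + ennreal (weight u)"
          using 3 lam_pos by (simp add: ennreal_mult)
        finally show ?thesis using 3 lam_pos by (simp add: add_increasing)
      qed simp
    qed
    also have "\<dots> = ennreal C * ?J + ennreal ?c * abs_H y + (ennreal lam * (\<integral>\<^sup>+u. (ennreal (?h (0 + lam * u))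
        + ennreal (weight (0 + lam * u)) * indicator {lam<..} (0 + lam * u)) \<partial>lborel) + ?w 1)"
      by (simp add: nn_integral_add nn_integral_cmult abs_H_def del: add_0)
    also have "ennreal lam * (\<integral>\<^sup>+u. (ennreal (?h (0 + lam * u))
          + ennreal (weight (0 + lam * u)) * indicator {lam<..} (0 + lam * u)) \<partial>lborel)
        = (\<integral>\<^sup>+v. ennreal (?h v) + ennreal (weight v) * indicator {lam<..} v \<partial>lborel)"
      using nn_integral_real_affine[of "\<lambda>v. ennreal (?h v) + ennreal (weight v) * indicator {lam<..} v" lam 0] lam_pos
      by (simp del: add_0)
    also have "\<dots> = abs_H y + ?w lam"
      by (simp add: nn_integral_add abs_H_def)
    also have "ennreal C * ?J + ennreal ?c * abs_H y + (abs_H y + ?w lam + ?w 1)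
        = (ennreal C * ?J + ?w lam + ?w 1) + ennreal (?c + 1) * abs_H y"
    proof -
      have "ennreal (?c + 1) = ennreal ?c + 1" using dev_nonneg[of 1] by (subst ennreal_plus) auto
      then have "ennreal (?c + 1) * abs_H y = ennreal ?c * abs_H y + abs_H y"
        by (simp only: distrib_right mult_1)
      then show ?thesis by (simp only: ac_simps)
    qed
    finally show ?thesis .
  qed
  have "ennreal C * ?J + ?w lam + ?w 1 < \<infinity>"
    using w[OF lam_pos] w[of 1] dev_over_id_integrable by (simp add: ennreal_mult_less_top)
  then obtain C1 where "ennreal C * ?J + ?w lam + ?w 1 = ennreal C1"
    unfolding infinity_ennreal_def less_top_ennreal by blast
  with step show ?thesis by (intro exI[of _ C1] exI[of _ "?c + 1"]) simp
qed

lemma abs_H_step_finite: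
  assumes "abs_H y < \<infinity>"
  shows "(\<integral>\<^sup>+t. abs_H (lam * y + t) \<partial>\<mu>) < \<infinity>"
proof -
  obtain C1 C2 where "(\<integral>\<^sup>+t. abs_H (lam * y + t) \<partial>\<mu>) \<le> ennreal C1 + ennreal C2 * abs_H y"
    using abs_H_step_le by blast
  also have "\<dots> < \<infinity>" using assms by (simp add: ennreal_mult_less_top)
  finally show ?thesis .
qed

text \<open>Averaging \<open>H\<close> over one step replaces \<open>f u = exp (u * y - \<phi> u)\<close> by \<open>f (lam * u)\<close> in the integrand. The
  increment is therefore the Frullani integral of \<open>f\<close> divided by \<open>ln (1 / lam)\<close>; as \<open>f\<close> tends to 1 at 0,
  it equals 1.\<close>

theorem H_fun_step:
  assumes y: "abs_H y < \<infinity>"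
  shows "(\<integral>t. H_fun lam \<phi> (lam * y + t) \<partial>\<mu>) = H_fun lam \<phi> y + 1"
proof -
  interpret pair_sigma_finite \<mu> "lborel :: real measure" ..
  define f where "f u = exp (u * y) * exp (- \<phi> u)" for u
  have f_meas [measurable]: "f \<in> borel_measurable borel"
    unfolding f_def by measurable
  let ?F = "\<lambda>t u. indicator {0<..} u * H_integrand \<phi> (lam * y + t) u"
  have F_int: "integrable (\<mu> \<Otimes>\<^sub>M lborel) (\<lambda>(t, u). ?F t u)"
    unfolding integrable_iff_bounded
  proof
    show F_meas: "(\<lambda>(t, u). ?F t u) \<in> borel_measurable (\<mu> \<Otimes>\<^sub>M lborel)"
      unfolding H_integrand_def by measurable
    have "(\<integral>\<^sup>+p. ennreal (norm (case p of (t, u) \<Rightarrow> ?F t u)) \<partial>(\<mu> \<Otimes>\<^sub>M lborel))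
        = (\<integral>\<^sup>+t. abs_H (lam * y + t) \<partial>\<mu>)"
      using F_meas by (subst lborel.nn_integral_fst[symmetric]) (simp_all add: abs_H_def)
    with abs_H_step_finite[OF y]
    show "(\<integral>\<^sup>+p. ennreal (norm (case p of (t, u) \<Rightarrow> ?F t u)) \<partial>(\<mu> \<Otimes>\<^sub>M lborel)) < \<infinity>" by simp
  qed
  have H_y: "integrable lborel (\<lambda>u. indicator {0<..} u * H_integrand \<phi> y u)"
    using y unfolding abs_H_finite_iff by (simp add: set_integrable_def)
  have inner: "(\<integral>t. ?F t u \<partial>\<mu>)
      = indicator {0<..} u * H_integrand \<phi> y u + indicator {0<..} u * ((f (lam * u) - f u) / u)" for u
  proof (cases "u > 0")
    case True
    have "(\<integral>t. ?F t u \<partial>\<mu>) = (\<integral>t. (exp (u * (lam * y + t)) - 1) * weight u \<partial>\<mu>)"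
      using True by (simp add: H_integrand_def)
    also have "\<dots> = (\<integral>t. exp (u * (lam * y + t)) - 1 \<partial>\<mu>) * weight u"
      by (rule integral_mult_left_zero)
    also have "\<dots> = (exp (lam * u * y) * mgf u - 1) * weight u"
      using True shift_exp_integrable[of u y] by (simp add: shift_exp_mean prob_space[simplified])
    also have "\<dots> = (exp (lam * u * y) * (mgf u * exp (- \<phi> u)) - exp (- \<phi> u)) / u"
      by (simp add: algebra_simps diff_divide_distrib)
    also have "\<dots> = (f (lam * u) - exp (- \<phi> u)) / u"
      using True by (simp add: mgf_mult_exp_neg_cumulant_series f_def)
    also have "\<dots> = H_integrand \<phi> y u + (f (lam * u) - f u) / u"
      by (simp add: H_integrand_def f_def algebra_simps diff_divide_distrib add_divide_distrib)
    finally show ?thesis using True by simp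
  qed simp
  have diff_int: "integrable lborel (\<lambda>u. indicator {0<..} u * ((f (lam * u) - f u) / u))"
    using Bochner_Integration.integrable_diff[OF integrable_snd[OF F_int] H_y] unfolding inner by simp
  have frullani: "(LBINT u:{0<..}. (f (lam * u) - f u) / u) = 1 * ln (1 / lam)"
  proof (rule frullani_integral[OF f_meas lam_pos lam_less_1])
    fix \<delta> :: real assume "\<delta> > 0"
    have "set_integrable lborel {\<delta><..} (H_integrand \<phi> y)"
      using y \<open>\<delta> > 0\<close> unfolding abs_H_finite_iff by (rule_tac set_integrable_subset) auto
    from set_integral_add(1)[OF this weight_integrable[OF \<open>\<delta> > 0\<close>]]
    show "set_integrable lborel {\<delta><..} (\<lambda>u. f u / u)"
      by (simp add: H_integrand_def f_def algebra_simps diff_divide_distrib)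
  next
    have "((\<lambda>u. exp (u * y) * exp (- \<phi> u)) \<longlongrightarrow> exp (0 * y) * exp (- 0)) (at_right 0)"
      by (intro tendsto_intros cumulant_series_tendsto_0)
    then show "(f \<longlongrightarrow> 1) (at_right 0)" by (simp add: f_def[abs_def])
  next
    show "set_integrable lborel {0<..} (\<lambda>u. (f (lam * u) - f u) / u)"
      using diff_int by (simp add: set_integrable_def)
  qed
  have "(\<integral>t. (LBINT u:{0<..}. H_integrand \<phi> (lam * y + t) u) \<partial>\<mu>) = (LINT u|lborel. (\<integral>t. ?F t u \<partial>\<mu>))"
    unfolding integral_fst[OF F_int, symmetric] integral_snd[OF F_int] set_lebesgue_integral_def
    by (simp add: integral_fst[OF F_int])
  also have "\<dots> = (LBINT u:{0<..}. H_integrand \<phi> y u) + ln (1 / lam)"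
    using H_y diff_int frullani by (simp only: inner) (simp add: set_lebesgue_integral_def)
  finally show ?thesis
    using log_inverse_lam_pos unfolding H_fun_def
    by (simp only: integral_mult_right_zero) (simp add: distrib_left)
qed

end

section \<open>The autoregressive process\<close>

text \<open>Here \<open>\<mu>\<close> is the common law of the innovations and \<open>x\<close> is the starting point; the integrability
  conditions of the law are imposed at that point.\<close>

locale ar1_process = prob_space M for M :: "'a measure" +
  fixes \<eta> :: "nat \<Rightarrow> 'a \<Rightarrow> real" and \<mu> :: "real measure" and lam x :: real
  assumes indep: "indep_vars (\<lambda>_. borel) \<eta> {1..}"
    and ident: "\<And>n. n \<ge> 1 \<Longrightarrow> distr M borel (\<eta> n) = \<mu>"
    and law: "integrable_innovation_law \<mu> lam x"
begin

sublocale law: integrable_innovation_law \<mu> lam x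
  by (rule law)

abbreviation X :: "nat \<Rightarrow> 'a \<Rightarrow> real" where
  "X \<equiv> ar1 lam x \<eta>"

abbreviation H :: "real \<Rightarrow> real" where
  "H \<equiv> H_fun lam law.\<phi>"

text \<open>The innovations up to time \<open>n\<close> as one random vector, an extensional function on \<open>{0<..n}\<close>, and the
  position of the chain as a function of that vector. The latter is the recursion itself, run on the
  coordinate functions.\<close>

definition history :: "nat \<Rightarrow> 'a \<Rightarrow> nat \<Rightarrow> real" where
  "history n \<omega> = restrict (\<lambda>i. \<eta> i \<omega>) {0<..n}"

abbreviation history_space :: "nat \<Rightarrow> (nat \<Rightarrow> real) measure" where
  "history_space n \<equiv> PiM {0<..n} (\<lambda>_. borel)"

definition position :: "nat \<Rightarrow> (nat \<Rightarrow> real) \<Rightarrow> real" where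
  "position = ar1 lam x (\<lambda>i v. v i)"

lemma innovation_measurable: "n \<ge> 1 \<Longrightarrow> \<eta> n \<in> borel_measurable M"
  using indep unfolding indep_vars_def by auto

lemma history_measurable [measurable]: "history n \<in> M \<rightarrow>\<^sub>M history_space n"
  unfolding history_def by (intro measurable_restrict innovation_measurable) auto

lemma position_measurable: "k \<le> n \<Longrightarrow> position k \<in> borel_measurable (history_space n)"
proof (induction k)
  case (Suc k)
  have [measurable]: "ar1 lam x (\<lambda>i v. v i) k \<in> borel_measurable (history_space n)"
    using Suc unfolding position_def by simp
  have [measurable]: "(\<lambda>v. v (Suc k)) \<in> borel_measurable (history_space n)"
    using Suc.prems by (intro measurable_component_singleton) simp
  show ?case unfolding position_def by simp
qed (simp add: position_def)

lemma position_measurable_self [measurable]: "position n \<in> borel_measurable (history_space n)"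
  by (rule position_measurable) simp

lemma position_history: "k \<le> n \<Longrightarrow> position k (history n \<omega>) = X k \<omega>"
  by (induction k) (simp_all add: position_def history_def)

lemma X_measurable [measurable]: "X n \<in> borel_measurable M"
proof -
  have "(\<lambda>\<omega>. position n (history n \<omega>)) \<in> borel_measurable M" by measurable
  then show ?thesis by (simp add: position_history)
qed

lemma X_Suc: "X (Suc n) \<omega> = lam * position n (history n \<omega>) + \<eta> (Suc n) \<omega>"
  by (simp add: position_history)

text \<open>The next innovation is independent of the past and has law \<open>\<mu>\<close>.\<close>

lemma distr_history_innovation:
  "distr M (history_space n \<Otimes>\<^sub>M borel) (\<lambda>\<omega>. (history n \<omega>, \<eta> (Suc n) \<omega>))
    = distr M (history_space n) (history n) \<Otimes>\<^sub>M \<mu>"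
proof -
  let ?S = "history_space n" and ?T = "PiM {Suc n} (\<lambda>_. borel) :: (nat \<Rightarrow> real) measure"
  let ?next = "\<lambda>\<omega>. restrict (\<lambda>i. \<eta> i \<omega>) {Suc n}"
  let ?e = "\<lambda>v :: nat \<Rightarrow> real. v (Suc n)"
  have [measurable]: "?e \<in> borel_measurable ?T" by (rule measurable_component_singleton) simp
  have next_meas [measurable]: "?next \<in> M \<rightarrow>\<^sub>M ?T"
    by (intro measurable_restrict innovation_measurable) auto
  have "indep_var ?S (\<lambda>\<omega>. restrict (\<lambda>i. \<eta> i \<omega>) {0<..n}) ?T ?next"
    by (rule indep_var_restrict[OF indep]) auto
  then have pair: "distr M ?S (history n) \<Otimes>\<^sub>M distr M ?T ?next = distr M (?S \<Otimes>\<^sub>M ?T) (\<lambda>\<omega>. (history n \<omega>, ?next \<omega>))"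
    unfolding indep_var_distribution_eq history_def[symmetric] by simp
  have \<mu>: "\<mu> = distr (distr M ?T ?next) borel ?e"
    using ident[of "Suc n"] by (simp add: distr_distr comp_def)
  have "distr M ?S (history n) \<Otimes>\<^sub>M \<mu>
      = distr (distr M ?S (history n)) ?S (\<lambda>v. v) \<Otimes>\<^sub>M distr (distr M ?T ?next) borel ?e"
    unfolding \<mu>[symmetric] by (simp add: distr_distr comp_def)
  also have "\<dots> = distr (distr M ?S (history n) \<Otimes>\<^sub>M distr M ?T ?next) (?S \<Otimes>\<^sub>M borel) (\<lambda>(v, w). (v, ?e w))"
    by (rule pair_measure_distr) (simp_all add: \<mu>[symmetric] law.sigma_finite_measure_axioms)
  also have "\<dots> = distr M (?S \<Otimes>\<^sub>M borel) (\<lambda>\<omega>. (history n \<omega>, \<eta> (Suc n) \<omega>))"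
    unfolding pair by (subst distr_distr) (simp_all add: comp_def)
  finally show ?thesis ..
qed

lemma history_innovation_measurable [measurable]:
  "(\<lambda>\<omega>. (history n \<omega>, \<eta> (Suc n) \<omega>)) \<in> M \<rightarrow>\<^sub>M history_space n \<Otimes>\<^sub>M borel"
  using innovation_measurable[of "Suc n"] by simp

text \<open>Started at \<open>x\<close>, where \<open>abs_H\<close> is finite, the chain keeps \<open>abs_H\<close> integrable at all times, and in
  particular almost surely finite.\<close>

lemma nn_integral_abs_H_finite: "(\<integral>\<^sup>+\<omega>. law.abs_H (X n \<omega>) \<partial>M) < \<infinity>"
proof (induction n)
  case 0
  show ?case using law.abs_H_x_finite by (simp add: emeasure_space_1)
next
  case (Suc n)
  let ?P = "distr M (history_space n) (history n)"
  obtain C1 C2 where C: "\<And>y. (\<integral>\<^sup>+t. law.abs_H (lam * y + t) \<partial>\<mu>) \<le> ennreal C1 + ennreal C2 * law.abs_H y"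
    using law.abs_H_step_le by blast
  have "(\<integral>\<^sup>+\<omega>. law.abs_H (X (Suc n) \<omega>) \<partial>M)
      = (\<integral>\<^sup>+p. law.abs_H (lam * position n (fst p) + snd p)
          \<partial>distr M (history_space n \<Otimes>\<^sub>M borel) (\<lambda>\<omega>. (history n \<omega>, \<eta> (Suc n) \<omega>)))"
    by (subst nn_integral_distr) (simp_all add: position_history)
  also have "\<dots> = (\<integral>\<^sup>+p. law.abs_H (lam * position n (fst p) + snd p) \<partial>(?P \<Otimes>\<^sub>M \<mu>))"
    by (simp only: distr_history_innovation)
  also have "\<dots> = (\<integral>\<^sup>+v. \<integral>\<^sup>+t. law.abs_H (lam * position n v + t) \<partial>\<mu> \<partial>?P)"
    by (subst law.nn_integral_fst[symmetric]) simp_all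
  also have "\<dots> \<le> (\<integral>\<^sup>+v. ennreal C1 + ennreal C2 * law.abs_H (position n v) \<partial>?P)"
    by (intro nn_integral_mono C)
  also have "\<dots> = (\<integral>\<^sup>+\<omega>. ennreal C1 + ennreal C2 * law.abs_H (X n \<omega>) \<partial>M)"
    by (subst nn_integral_distr) (simp_all add: position_history)
  also have "\<dots> = ennreal C1 + ennreal C2 * (\<integral>\<^sup>+\<omega>. law.abs_H (X n \<omega>) \<partial>M)"
    by (simp add: nn_integral_add nn_integral_cmult emeasure_space_1)
  also have "\<dots> < \<infinity>" using Suc by (simp add: ennreal_mult_less_top)
  finally show ?case .
qed

lemma H_X_integrable: "integrable M (\<lambda>\<omega>. H (X n \<omega>))"
proof (rule integrableI_bounded)
  have "(\<integral>\<^sup>+\<omega>. ennreal (norm (H (X n \<omega>))) \<partial>M)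
      \<le> (\<integral>\<^sup>+\<omega>. ennreal (1 / ln (1 / lam)) * law.abs_H (X n \<omega>) \<partial>M)"
    unfolding real_norm_def by (intro nn_integral_mono law.abs_H_fun_le)
  also have "\<dots> = ennreal (1 / ln (1 / lam)) * (\<integral>\<^sup>+\<omega>. law.abs_H (X n \<omega>) \<partial>M)"
    by (rule nn_integral_cmult) simp
  also have "\<dots> < \<infinity>" using nn_integral_abs_H_finite[of n] by (simp add: ennreal_mult_less_top)
  finally show "(\<integral>\<^sup>+\<omega>. ennreal (norm (H (X n \<omega>))) \<partial>M) < \<infinity>" .
qed simp

text \<open>Independence turns the expectation into an iterated integral, whose inner part is \<open>law.H_fun_step\<close>.\<close>

lemma integral_H_X_Suc:
  assumes B [measurable]: "B \<in> sets (history_space n)"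
  shows "(\<integral>\<omega>. indicator B (history n \<omega>) * H (X (Suc n) \<omega>) \<partial>M)
    = (\<integral>\<omega>. indicator B (history n \<omega>) * (H (X n \<omega>) + 1) \<partial>M)"
proof -
  let ?P = "distr M (history_space n) (history n)"
  let ?G = "\<lambda>p. indicator B (fst p) * H (lam * position n (fst p) + snd p)"
  interpret P: prob_space ?P by (rule prob_space_distr) simp
  interpret pair_sigma_finite ?P \<mu> ..
  have eq: "?G (history n \<omega>, \<eta> (Suc n) \<omega>) = indicator B (history n \<omega>) * H (X (Suc n) \<omega>)" for \<omega>
    by (simp add: position_history)
  have int: "integrable M (\<lambda>\<omega>. ?G (history n \<omega>, \<eta> (Suc n) \<omega>))"
    unfolding eq
    by (rule Bochner_Integration.integrable_bound[OF H_X_integrable[of "Suc n"]])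
       (auto simp: indicator_def simp del: ar1.simps)
  then have "integrable (distr M (history_space n \<Otimes>\<^sub>M borel) (\<lambda>\<omega>. (history n \<omega>, \<eta> (Suc n) \<omega>))) ?G"
    by (subst integrable_distr_eq) simp_all
  then have G_int: "integrable (?P \<Otimes>\<^sub>M \<mu>) ?G" by (simp only: distr_history_innovation)
  have "AE \<omega> in M. law.abs_H (X n \<omega>) \<noteq> \<infinity>"
    using nn_integral_abs_H_finite[of n] by (intro nn_integral_noteq_infinite) auto
  then have fin: "AE v in ?P. law.abs_H (position n v) < \<infinity>"
    by (subst AE_distr_iff) (simp_all add: position_history less_top)
  have "(\<integral>\<omega>. indicator B (history n \<omega>) * H (X (Suc n) \<omega>) \<partial>M)
      = (\<integral>p. ?G p \<partial>distr M (history_space n \<Otimes>\<^sub>M borel) (\<lambda>\<omega>. (history n \<omega>, \<eta> (Suc n) \<omega>)))"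
    by (subst integral_distr) (simp_all add: position_history)
  also have "\<dots> = (\<integral>p. ?G p \<partial>(?P \<Otimes>\<^sub>M \<mu>))" by (simp only: distr_history_innovation)
  also have "\<dots> = (\<integral>v. (\<integral>t. ?G (v, t) \<partial>\<mu>) \<partial>?P)" by (rule integral_fst'[OF G_int, symmetric])
  also have "\<dots> = (\<integral>v. indicator B v * (H (position n v) + 1) \<partial>?P)"
  proof (rule integral_cong_AE)
    show "(\<lambda>v. \<integral>t. ?G (v, t) \<partial>\<mu>) \<in> borel_measurable ?P"
      by (rule borel_measurable_integrable[OF integrable_fst'[OF G_int]])
    show "AE v in ?P. (\<integral>t. ?G (v, t) \<partial>\<mu>) = indicator B v * (H (position n v) + 1)"
      using fin
    proof eventually_elim
      case (elim v)
      have "(\<integral>t. ?G (v, t) \<partial>\<mu>) = indicator B v * (\<integral>t. H (lam * position n v + t) \<partial>\<mu>)"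
        unfolding fst_conv snd_conv by (rule integral_mult_right_zero)
      then show ?case by (simp only: law.H_fun_step[OF elim])
    qed
  qed simp
  also have "\<dots> = (\<integral>\<omega>. indicator B (history n \<omega>) * (H (X n \<omega>) + 1) \<partial>M)"
    by (subst integral_distr) (simp_all add: position_history)
  finally show ?thesis .
qed

section \<open>The martingale property\<close>

abbreviation F :: "nat \<Rightarrow> 'a measure" where
  "F \<equiv> natural_filtration M X"

lemma space_F [simp]: "space (F n) = space M"
  unfolding natural_filtration_def by (rule space_measure_of) auto

lemma sets_F: "sets (F n) = sigma_sets (space M) {X k -` B \<inter> space M |k B. k \<le> n \<and> B \<in> sets borel}"
  unfolding natural_filtration_def by (rule sets_measure_of) auto

lemma F_mono: "m \<le> n \<Longrightarrow> sets (F m) \<subseteq> sets (F n)"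
  unfolding sets_F by (rule sigma_sets_mono') force

lemma F_subalgebra: "subalgebra M (F n)"
proof -
  have "{X k -` B \<inter> space M |k B. k \<le> n \<and> B \<in> sets borel} \<subseteq> sets M"
    using measurable_sets[OF X_measurable] by auto
  then show ?thesis unfolding subalgebra_def sets_F by (simp add: sets.sigma_sets_subset)
qed

lemma X_measurable_F: "X n \<in> borel_measurable (F n)"
proof (rule measurableI)
  fix B :: "real set" assume "B \<in> sets borel"
  then show "X n -` B \<inter> space (F n) \<in> sets (F n)"
    unfolding space_F sets_F by (intro sigma_sets.Basic) blast
qed simp

text \<open>Every event of \<open>F n\<close> is determined by the first \<open>n\<close> innovations.\<close>

lemma F_history:
  assumes "A \<in> sets (F n)"
  obtains B where "B \<in> sets (history_space n)" "A = history n -` B \<inter> space M"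
proof -
  have range: "history n \<in> space M \<rightarrow> space (history_space n)"
    using measurable_space[OF history_measurable] by auto
  let ?V = "vimage_algebra (space M) (history n) (history_space n)"
  have "{X k -` B \<inter> space M |k B. k \<le> n \<and> B \<in> sets borel} \<subseteq> sets ?V"
  proof safe
    fix k and B :: "real set" assume k: "k \<le> n" and B: "B \<in> sets borel"
    have "(\<lambda>\<omega>. position k (history n \<omega>)) \<in> borel_measurable ?V"
      by (rule measurable_compose[OF measurable_vimage_algebra1[OF range] position_measurable[OF k]])
    from measurable_sets[OF this B] show "X k -` B \<inter> space M \<in> sets ?V"
      using k by (simp add: position_history)
  qed
  then have "sets (F n) \<subseteq> sets ?V"
    unfolding sets_F using sets.sigma_sets_subset[of _ ?V] by simp
  with assms show ?thesis using that unfolding sets_vimage_algebra2[OF range] by blast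
qed

lemma cond_exp_step: "AE \<omega> in M. real_cond_exp M (F n) (\<lambda>\<omega>. H (X (Suc n) \<omega>) - real (Suc n)) \<omega> = H (X n \<omega>) - real n"
proof -
  interpret fin: finite_measure_subalgebra M "F n"
    by unfold_locales (rule F_subalgebra)
  show ?thesis
  proof (rule fin.real_cond_exp_charact)
    fix A assume A: "A \<in> sets (F n)"
    then obtain B where B: "B \<in> sets (history_space n)" "A = history n -` B \<inter> space M"
      by (rule F_history)
    have A_M: "A \<in> sets M" using A F_subalgebra[of n] by (auto simp: subalgebra_def)
    have ind: "indicator A \<omega> = (indicator B (history n \<omega>) :: real)" if "\<omega> \<in> space M" for \<omega>
      using that B by (simp add: indicator_def)
    have int: "integrable M (\<lambda>\<omega>. indicator A \<omega> * f \<omega>)" if "integrable M f" for f :: "'a \<Rightarrow> real"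
      using integrable_mult_indicator[OF A_M that] by simp
    have "(\<integral>\<omega>. indicator A \<omega> * H (X (Suc n) \<omega>) \<partial>M) = (\<integral>\<omega>. indicator B (history n \<omega>) * H (X (Suc n) \<omega>) \<partial>M)"
      by (intro Bochner_Integration.integral_cong) (simp_all add: ind)
    also have "\<dots> = (\<integral>\<omega>. indicator B (history n \<omega>) * (H (X n \<omega>) + 1) \<partial>M)"
      by (rule integral_H_X_Suc[OF B(1)])
    also have "\<dots> = (\<integral>\<omega>. indicator A \<omega> * (H (X n \<omega>) + 1) \<partial>M)"
      by (intro Bochner_Integration.integral_cong) (simp_all add: ind)
    finally have step: "(\<integral>\<omega>. indicator A \<omega> * H (X (Suc n) \<omega>) \<partial>M) = (\<integral>\<omega>. indicator A \<omega> * (H (X n \<omega>) + 1) \<partial>M)" .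
    have "(\<integral>\<omega>. indicator A \<omega> * (H (X (Suc n) \<omega>) - real (Suc n)) \<partial>M)
        = (\<integral>\<omega>. indicator A \<omega> * H (X (Suc n) \<omega>) - indicator A \<omega> * real (Suc n) \<partial>M)"
      by (simp only: right_diff_distrib)
    also have "\<dots> = (\<integral>\<omega>. indicator A \<omega> * (H (X n \<omega>) + 1) \<partial>M) - (\<integral>\<omega>. indicator A \<omega> * real (Suc n) \<partial>M)"
      by (subst Bochner_Integration.integral_diff) (auto simp only: step intro!: int H_X_integrable integrable_const)
    also have "\<dots> = (\<integral>\<omega>. indicator A \<omega> * (H (X n \<omega>) + 1) - indicator A \<omega> * real (Suc n) \<partial>M)"
      by (intro Bochner_Integration.integral_diff[symmetric] int Bochner_Integration.integrable_add H_X_integrable integrable_const)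
    also have "\<dots> = (\<integral>\<omega>. indicator A \<omega> * (H (X n \<omega>) - real n) \<partial>M)"
      by (intro Bochner_Integration.integral_cong) (simp_all add: algebra_simps)
    finally show "(LINT \<omega>:A|M. H (X (Suc n) \<omega>) - real (Suc n)) = (LINT \<omega>:A|M. H (X n \<omega>) - real n)"
      by (simp only: set_lebesgue_integral_def real_scaleR_def)
  next
    show "integrable M (\<lambda>\<omega>. H (X (Suc n) \<omega>) - real (Suc n))" "integrable M (\<lambda>\<omega>. H (X n \<omega>) - real n)"
      by (intro Bochner_Integration.integrable_diff H_X_integrable integrable_const)+
    show "(\<lambda>\<omega>. H (X n \<omega>) - real n) \<in> borel_measurable (F n)"
      using X_measurable_F[of n] by simp
  qed
qed

theorem H_X_martingale: "martingale M F (\<lambda>n \<omega>. H (X n \<omega>) - real n)"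
  unfolding martingale_def
proof (intro conjI allI impI)
  let ?Y = "\<lambda>n \<omega>. H (X n \<omega>) - real n"
  show "filtration (space M) F" by unfold_locales (simp_all add: F_mono)
  show "subalgebra M (F n)" for n by (rule F_subalgebra)
  show Y_F: "?Y n \<in> borel_measurable (F n)" for n using X_measurable_F[of n] by simp
  show Y_int: "integrable M (?Y n)" for n
    by (intro Bochner_Integration.integrable_diff H_X_integrable integrable_const)
  fix m n :: nat assume "m \<le> n"
  interpret fin: finite_measure_subalgebra M "F m"
    by unfold_locales (rule F_subalgebra)
  show "AE \<omega> in M. real_cond_exp M (F m) (?Y n) \<omega> = ?Y m \<omega>"
    using \<open>m \<le> n\<close>
  proof (induction n rule: dec_induct)
    case base
    show ?case by (rule fin.real_cond_exp_F_meas[OF Y_int Y_F])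
  next
    case (step k)
    have "subalgebra (F k) (F m)" using step.hyps by (simp add: subalgebra_def F_mono)
    from fin.real_cond_exp_nested_subalg[OF F_subalgebra this Y_int[of "Suc k"]]
    have "AE \<omega> in M. real_cond_exp M (F m) (real_cond_exp M (F k) (?Y (Suc k))) \<omega> = real_cond_exp M (F m) (?Y (Suc k)) \<omega>" .
    moreover have "AE \<omega> in M. real_cond_exp M (F m) (real_cond_exp M (F k) (?Y (Suc k))) \<omega> = real_cond_exp M (F m) (?Y k) \<omega>"
      by (rule fin.real_cond_exp_cong[OF cond_exp_step]) (simp_all del: ar1.simps of_nat_Suc)
    ultimately show ?case using step.IH by eventually_elim (simp del: ar1.simps of_nat_Suc)
  qed
qed

end

theorem proposition2:
  fixes M :: "'a measure" and \<eta> :: "nat \<Rightarrow> 'a \<Rightarrow> real" and lam x :: real and D :: "real set"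
  defines "X \<equiv> ar1 lam x \<eta>"
    and "\<phi> \<equiv> cumulant_series M lam (\<eta> 1)"
  assumes "prob_space M"
    and "prob_space.indep_vars M (\<lambda>_. borel) \<eta> {1..}"
    and "\<And>n. n \<ge> 1 \<Longrightarrow> distr M borel (\<eta> n) = distr M borel (\<eta> 1)"
    and "0 < lam" and "lam < 1"
    and "x \<in> D" and "\<And>n. AE \<omega> in M. X n \<omega> \<in> D"
    and "\<And>u. u \<ge> 0 \<Longrightarrow> integrable M (\<lambda>\<omega>. exp (u * \<eta> 1 \<omega>))"
    and "integrable M (\<lambda>\<omega>. ln (1 + \<bar>\<eta> 1 \<omega>\<bar>))"
    and "\<And>y. y \<in> D \<Longrightarrow> set_integrable lborel {1..} (\<lambda>u. exp (u * y - \<phi> u) / u)"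
    and H_well_defined: "\<And>y. y \<in> D \<Longrightarrow> set_integrable lborel {0<..} (H_integrand \<phi> y)"
  shows "martingale M (natural_filtration M X) (\<lambda>n \<omega>. H_fun lam \<phi> (X n \<omega>) - real n)"
proof -
  interpret prob_space M by fact
  have meas [measurable]: "\<eta> 1 \<in> borel_measurable M"
    using assms(4) unfolding indep_vars_def by auto
  have "cumulant M (\<eta> 1) = cumulant (distr M borel (\<eta> 1)) (\<lambda>t. t)"
    by (intro ext) (simp add: cumulant_def integral_distr del: One_nat_def)
  then have \<phi>: "\<phi> = cumulant_series (distr M borel (\<eta> 1)) lam (\<lambda>t. t)"
    unfolding assms(2) by (intro ext) (simp only: cumulant_series_def)
  have law: "integrable_innovation_law (distr M borel (\<eta> 1)) lam x"
  proof (intro integrable_innovation_law.intro innovation_law.intro prob_space_distr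
      innovation_law_axioms.intro integrable_innovation_law_axioms.intro)
    show "integrable (distr M borel (\<eta> 1)) (\<lambda>t. exp (u * t))" if "u \<ge> 0" for u
      using assms(10)[OF that] by (subst integrable_distr_eq) (simp_all del: One_nat_def)
    show "integrable (distr M borel (\<eta> 1)) (\<lambda>t. ln (1 + \<bar>t\<bar>))"
      using assms(11) by (subst integrable_distr_eq) (simp_all del: One_nat_def)
    show "set_integrable lborel {1..} (\<lambda>u. exp (u * x - cumulant_series (distr M borel (\<eta> 1)) lam (\<lambda>t. t) u) / u)"
      using assms(12)[OF \<open>x \<in> D\<close>] unfolding \<phi> .
    show "set_integrable lborel {0<..} (H_integrand (cumulant_series (distr M borel (\<eta> 1)) lam (\<lambda>t. t)) x)"
      using H_well_defined[OF \<open>x \<in> D\<close>] unfolding \<phi> .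
  qed (simp_all only: meas sets_distr assms(6,7))
  interpret ar1_process M \<eta> "distr M borel (\<eta> 1)" lam x
    by (intro ar1_process.intro ar1_process_axioms.intro prob_space_axioms assms(4,5) law)
  show ?thesis using H_X_martingale unfolding assms(1) \<phi> .
qed

end
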